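(* For an arbitrary positive real $X$ let $$S_f(X)=\big\{\lfloor f(n)\rfloor : 1\le n\le X\big\},$$ where $f(y)=f(X,y)$ is a non-negative twice differentiable function and there exists a unique value $a=a(X)\in[1,X]$ such that $\frac{df}{dy}\big|_{y=a}=\pm 1$. Then (i) if, for all $y\in[1,X]$, we have $f'(y)<0$ and $f''(y)>0$, then $$|S_f(X)|=f(\lfloor a+1\rfloor)-f(\lfloor X\rfloor)+a+O(1);$$ (ii) if, for all $y\in[1,X]$, we have $f'(y)<0$ and $f''(y)<0$, then $$|S_f(X)|=f(1)-f(\lfloor a\rfloor)+X-a+O(1);$$ (iii) if, for all $y\in[1,X]$, we have $f'(y)>0$ and $f''(y)>0$, then $$|S_f(X)|=f(\lfloor a\rfloor)-f(1)+X-a+O(1);$$ (iv) if, for all $y\in[1,X]$, we have $f'(y)>0$ and $f''(y)<0$, then $$|S_f(X)|=f(\lfloor X\rfloor)-f(\lfloor a+1\rfloor)+a+O(1).$$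
   Context: Here $n$ runs over integers, $\lfloor x\rfloor$ denotes the greatest integer not exceeding the real number $x$, and $|S|$ denotes the number of distinct elements of a finite set $S$. The function $f$ of the variable $y$ may depend on the parameter $X$, as indicated by $f(y)=f(X,y)$, and primes denote derivatives with respect to $y$. The symbol $O(1)$ denotes a quantity bounded in absolute value by an absolute constant.
   Formalization: In (i) and (iv) the formal statement adds the hypothesis ⌊a+1⌋ ≤ X: otherwise f(⌊a+1⌋) lies outside [1,X], where f is undefined or unconstrained, and the formula can fail (e.g. X = a = 2.9 with f very steep on [1,2.8]). *)

theory Defs
  imports Complex_Main
begin

definition floor_set :: "(real \<Rightarrow> real) \<Rightarrow> real \<Rightarrow> int set" where
  "floor_set f X = (\<lambda>n. \<lfloor>f (real_of_int n)\<rfloor>) ` {n::int. 1 \<le> n \<and> real_of_int n \<le> X}"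

text \<open>
  The function lives on [1, X], so derivatives are taken within that interval (one-sided at the
  end points) and its value at the integer part of a + 1 is meaningful only if that integer is
  at most X. Beyond X the count formulas using this value can fail, even if the function extends
  smoothly with the same signs of its derivatives: f may drop by a large amount between the
  integer part of X and a.
\<close>
definition admissible ::
  "real \<Rightarrow> (real \<Rightarrow> real) \<Rightarrow> (real \<Rightarrow> real) \<Rightarrow> (real \<Rightarrow> real) \<Rightarrow> real \<Rightarrow> bool" where
  "admissible X f f' f'' a \<longleftrightarrow>
     (\<forall>y\<in>{1..X}. 0 \<le> f y) \<and>
     (\<forall>y\<in>{1..X}. (f has_real_derivative f' y) (at y within {1..X})) \<and>
     (\<forall>y\<in>{1..X}. (f' has_real_derivative f'' y) (at y within {1..X})) \<and>
     {y\<in>{1..X}. f' y = 1 \<or> f' y = - 1} = {a}"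

end

theory Submission
  imports Defs "HOL-Analysis.Derivative"
begin

text \<open>
  The point \<open>a\<close> cuts \<open>[1, X]\<close> into a steep part, where \<open>\<bar>f'\<bar> > 1\<close>, and a shallow
  part, where \<open>\<bar>f'\<bar> < 1\<close>; the sign of \<open>f''\<close> decides which comes first. By the mean value
  theorem, consecutive values \<open>f n\<close> and \<open>f (n + 1)\<close> differ by at least 1 on the steep part, so
  their floors are pairwise distinct and the steep part contributes one element per integer
  (\<open>card_floor_image_steep\<close>). On the shallow part they differ by at most 1, so no integer between
  the extreme floors is skipped and the contribution is the total variation of \<open>f\<close> there, up
  to \<open>O(1)\<close> (\<open>floor_image_shallow\<close>). As \<open>f\<close> is monotone, the two parts share at most one floor,
  so adding up the contributions miscounts by at most one (\<open>card_floor_image_split\<close>).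

  Only the sequence of values at the integers matters after the mean value theorem has been
  applied. The set of floors ignores the order of that sequence, so a decreasing sequence can be
  read backwards; this exchanges the two arrangements of steep and shallow parts and reduces
  cases (i) and (ii) to the counts used for (iii) and (iv).
\<close>

section \<open>Floors of increasing sequences\<close>

text \<open>
  The increment bound 0 expresses monotonicity, the increment bound 1 the growth on a steep part.
\<close>
lemma increments_bounded_below:
  fixes g :: "int \<Rightarrow> real"
  assumes step: "\<And>n. p \<le> n \<Longrightarrow> n < q \<Longrightarrow> g n + c \<le> g (n + 1)"
    and "p \<le> i" "i \<le> j" "j \<le> q"
  shows "g i + c * real_of_int (j - i) \<le> g j"
  using \<open>i \<le> j\<close> \<open>j \<le> q\<close>
proof (induction j rule: int_ge_induct)
  case base
  then show ?case by simp
next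
  case (step j)
  have "g j + c \<le> g (j + 1)"
    using assms(1)[of j] step.hyps step.prems \<open>p \<le> i\<close> by simp
  with step show ?case by (simp add: algebra_simps)
qed

lemma floor_image_shallow:
  fixes g :: "int \<Rightarrow> real"
  assumes "p \<le> q"
    and "\<And>n. p \<le> n \<Longrightarrow> n < q \<Longrightarrow> g n \<le> g (n + 1) \<and> g (n + 1) \<le> g n + 1"
  shows "(\<lambda>n. \<lfloor>g n\<rfloor>) ` {p..q} = {\<lfloor>g p\<rfloor>..\<lfloor>g q\<rfloor>}"
  using assms
proof (induction q rule: int_ge_induct)
  case base
  then show ?case by simp
next
  case (step q)
  have IH: "(\<lambda>n. \<lfloor>g n\<rfloor>) ` {p..q} = {\<lfloor>g p\<rfloor>..\<lfloor>g q\<rfloor>}"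
    using step by simp
  have "g q \<le> g (q + 1)" "g (q + 1) \<le> g q + 1"
    using step.prems[of q] step.hyps by auto
  then have next_floor: "\<lfloor>g (q + 1)\<rfloor> = \<lfloor>g q\<rfloor> \<or> \<lfloor>g (q + 1)\<rfloor> = \<lfloor>g q\<rfloor> + 1"
    by linarith
  have "\<lfloor>g p\<rfloor> \<in> (\<lambda>n. \<lfloor>g n\<rfloor>) ` {p..q}"
    using step.hyps by simp
  with IH have "\<lfloor>g p\<rfloor> \<le> \<lfloor>g q\<rfloor>"
    by simp
  moreover have "{p..q + 1} = insert (q + 1) {p..q}"
    using step.hyps by auto
  ultimately show ?case
    using IH next_floor by auto
qed

lemma card_floor_image_steep:
  fixes g :: "int \<Rightarrow> real"
  assumes step: "\<And>n. p \<le> n \<Longrightarrow> n < q \<Longrightarrow> g n + 1 \<le> g (n + 1)"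
  shows "card ((\<lambda>n. \<lfloor>g n\<rfloor>) ` {p..q}) = nat (q - p + 1)"
proof -
  have "\<lfloor>g i\<rfloor> < \<lfloor>g j\<rfloor>" if "p \<le> i" "i < j" "j \<le> q" for i j
  proof -
    have "g i + 1 * real_of_int (j - i) \<le> g j"
      using increments_bounded_below[where c = 1 and g = g and p = p and q = q] step that by simp
    moreover have "1 \<le> real_of_int (j - i)"
      using \<open>i < j\<close> by linarith
    ultimately have "g i + 1 \<le> g j"
      by simp
    then show ?thesis
      using floor_mono[of "g i + 1" "g j"] by simp
  qed
  then have "inj_on (\<lambda>n. \<lfloor>g n\<rfloor>) {p..q}"
    by (intro linorder_inj_onI) force+
  then show ?thesis
    by (simp add: card_image)
qed

lemma card_floor_image_split:
  fixes g :: "int \<Rightarrow> real"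
  assumes mono: "\<And>n. p \<le> n \<Longrightarrow> n < q \<Longrightarrow> g n \<le> g (n + 1)"
    and "p \<le> m + 1" "m \<le> q"
  defines "S \<equiv> \<lambda>i j. (\<lambda>n. \<lfloor>g n\<rfloor>) ` {i..j}"
  shows "card (S p q) \<le> card (S p m) + card (S (m + 1) q)"
    and "card (S p m) + card (S (m + 1) q) \<le> card (S p q) + 1"
proof -
  have "{p..q} = {p..m} \<union> {m + 1..q}"
    using \<open>p \<le> m + 1\<close> \<open>m \<le> q\<close> by auto
  then have union: "S p q = S p m \<union> S (m + 1) q"
    by (simp add: S_def image_Un)
  have le: "g i \<le> g j" if "p \<le> i" "i \<le> j" "j \<le> q" for i j
    using increments_bounded_below[where c = 0 and g = g and p = p and q = q] mono that by simp
  \<comment> \<open>A common floor lies on both sides of the floor at the cut, hence equals it.\<close>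
  have "S p m \<inter> S (m + 1) q \<subseteq> {\<lfloor>g m\<rfloor>}"
  proof
    fix v assume "v \<in> S p m \<inter> S (m + 1) q"
    then have "v \<in> S p m" "v \<in> S (m + 1) q"
      by simp_all
    then obtain i j where "v = \<lfloor>g i\<rfloor>" "p \<le> i" "i \<le> m" "v = \<lfloor>g j\<rfloor>" "m + 1 \<le> j" "j \<le> q"
      unfolding S_def image_iff Bex_def atLeastAtMost_iff by blast
    then have "v \<le> \<lfloor>g m\<rfloor>" "\<lfloor>g m\<rfloor> \<le> v"
      using floor_mono[OF le[of i m]] floor_mono[OF le[of m j]] \<open>m \<le> q\<close> by simp_all
    then show "v \<in> {\<lfloor>g m\<rfloor>}"
      by simp
  qed
  then have "card (S p m \<inter> S (m + 1) q) \<le> 1"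
    using card_mono[of "{\<lfloor>g m\<rfloor>}"] by simp
  moreover have "card (S p m) + card (S (m + 1) q) = card (S p q) + card (S p m \<inter> S (m + 1) q)"
    unfolding union by (rule card_Un_Int) (simp_all add: S_def)
  ultimately show "card (S p q) \<le> card (S p m) + card (S (m + 1) q)"
    and "card (S p m) + card (S (m + 1) q) \<le> card (S p q) + 1"
    by simp_all
qed

section \<open>Sequences with one change of steepness\<close>

text \<open>
  The increment across the cut, from \<open>m\<close> to \<open>m + 1\<close>, is only assumed to be non-negative:
  the change of slope occurs somewhere within it. The bound 2 collects the rounding of the two
  end values, the 1 by which an integer interval has more elements than its length, and the at
  most one floor common to both parts; the errors of opposite sign partly cancel.
\<close>
lemma card_floor_image_shallow_steep:
  fixes g :: "int \<Rightarrow> real"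
  assumes "p \<le> m" "m \<le> q"
    and mono: "\<And>n. p \<le> n \<Longrightarrow> n < q \<Longrightarrow> g n \<le> g (n + 1)"
    and shallow: "\<And>n. p \<le> n \<Longrightarrow> n < m \<Longrightarrow> g (n + 1) \<le> g n + 1"
    and steep: "\<And>n. m < n \<Longrightarrow> n < q \<Longrightarrow> g n + 1 \<le> g (n + 1)"
  shows "\<bar>real (card ((\<lambda>n. \<lfloor>g n\<rfloor>) ` {p..q})) - (g m - g p + real_of_int (q - m))\<bar> \<le> 2"
proof -
  let ?S = "\<lambda>i j. (\<lambda>n. \<lfloor>g n\<rfloor>) ` {i..j}"
  have "?S p m = {\<lfloor>g p\<rfloor>..\<lfloor>g m\<rfloor>}"
    using assms by (intro floor_image_shallow) auto
  moreover have "g p \<le> g m"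
    using increments_bounded_below[where c = 0 and g = g and p = p and q = q] mono assms(1,2) by simp
  ultimately have "real (card (?S p m)) = real_of_int (\<lfloor>g m\<rfloor> - \<lfloor>g p\<rfloor> + 1)"
    by (simp add: floor_mono)
  moreover have "real (card (?S (m + 1) q)) = real_of_int (q - m)"
    using card_floor_image_steep[of "m + 1" q g] steep \<open>m \<le> q\<close> by simp
  moreover have "card (?S p q) \<le> card (?S p m) + card (?S (m + 1) q)"
    "card (?S p m) + card (?S (m + 1) q) \<le> card (?S p q) + 1"
    using card_floor_image_split[of p q g m] assms by simp_all
  ultimately show ?thesis
    by linarith
qed

text \<open>
  The steep part \<open>{p..m}\<close> may be empty here, which happens when a concave decreasing function
  reaches slope -1 only at or after the last integer of its domain and is read backwards.
\<close>
lemma card_floor_image_steep_shallow: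
  fixes g :: "int \<Rightarrow> real"
  assumes "p \<le> m + 1" "m < q"
    and mono: "\<And>n. p \<le> n \<Longrightarrow> n < q \<Longrightarrow> g n \<le> g (n + 1)"
    and steep: "\<And>n. p \<le> n \<Longrightarrow> n < m \<Longrightarrow> g n + 1 \<le> g (n + 1)"
    and shallow: "\<And>n. m < n \<Longrightarrow> n < q \<Longrightarrow> g (n + 1) \<le> g n + 1"
  shows "\<bar>real (card ((\<lambda>n. \<lfloor>g n\<rfloor>) ` {p..q})) - (g q - g (m + 1) + real_of_int (m - p + 1))\<bar> \<le> 2"
proof -
  let ?S = "\<lambda>i j. (\<lambda>n. \<lfloor>g n\<rfloor>) ` {i..j}"
  have "?S (m + 1) q = {\<lfloor>g (m + 1)\<rfloor>..\<lfloor>g q\<rfloor>}"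
    using assms by (intro floor_image_shallow) auto
  moreover have "g (m + 1) \<le> g q"
    using increments_bounded_below[where c = 0 and g = g and p = p and q = q] mono assms(1,2) by simp
  ultimately have "real (card (?S (m + 1) q)) = real_of_int (\<lfloor>g q\<rfloor> - \<lfloor>g (m + 1)\<rfloor> + 1)"
    by (simp add: floor_mono)
  moreover have "real (card (?S p m)) = real_of_int (m - p + 1)"
    using card_floor_image_steep[of p m g] steep \<open>p \<le> m + 1\<close> by simp
  moreover have "card (?S p q) \<le> card (?S p m) + card (?S (m + 1) q)"
    "card (?S p m) + card (?S (m + 1) q) \<le> card (?S p q) + 1"
    using card_floor_image_split[of p q g m] assms by simp_all
  ultimately show ?thesis
    by linarith
qed

section \<open>Slopes and increments\<close>

text \<open>
  On a subinterval that does not reach the end points of the domain this is the usual mean value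
  theorem; the one-sided derivatives at the end points extend it to the whole of \<open>[l, u]\<close>.
\<close>
lemma mean_value_within:
  fixes f :: "real \<Rightarrow> real"
  assumes "\<forall>y\<in>{l..u}. (f has_real_derivative f' y) (at y within {l..u})"
    and "l \<le> s" "s < t" "t \<le> u"
  shows "\<exists>\<xi>\<in>{s<..<t}. f t - f s = f' \<xi> * (t - s)"
proof (rule mvt_simple[OF \<open>s < t\<close>])
  fix y assume "s \<le> y" "y \<le> t"
  then have "(f has_real_derivative f' y) (at y within {s..t})"
    using assms by (intro has_field_derivative_subset[of f "f' y" y "{l..u}" "{s..t}"]) auto
  then show "(f has_derivative (*) (f' y)) (at y within {s..t})"
    by (simp add: has_field_derivative_def)
qed

lemma unit_increment_within:
  fixes f :: "real \<Rightarrow> real"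
  assumes "\<forall>y\<in>{l..u}. (f has_real_derivative f' y) (at y within {l..u})"
    and "l \<le> real_of_int n" "real_of_int n + 1 \<le> u"
  obtains \<xi> where "real_of_int n < \<xi>" "\<xi> < real_of_int n + 1"
    "f (real_of_int (n + 1)) - f (real_of_int n) = f' \<xi>"
  using mean_value_within[OF assms(1), of "real_of_int n" "real_of_int n + 1"] assms(2,3) that
  by auto

lemma pos_derivative_within_less:
  fixes f :: "real \<Rightarrow> real"
  assumes "\<forall>y\<in>{l..u}. (f has_real_derivative f' y) (at y within {l..u})"
    and "\<forall>y\<in>{l..u}. f' y > 0"
    and "l \<le> s" "s < t" "t \<le> u"
  shows "f s < f t"
proof -
  obtain \<xi> where \<xi>: "s < \<xi>" "\<xi> < t" "f t - f s = f' \<xi> * (t - s)"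
    using mean_value_within[OF assms(1,3-5)] by auto
  have "f' \<xi> * (t - s) > 0"
    using assms \<xi> by (intro mult_pos_pos) auto
  with \<xi> show ?thesis by simp
qed

lemma neg_derivative_within_less:
  fixes f :: "real \<Rightarrow> real"
  assumes deriv: "\<forall>y\<in>{l..u}. (f has_real_derivative f' y) (at y within {l..u})"
    and neg: "\<forall>y\<in>{l..u}. f' y < 0"
    and "l \<le> s" "s < t" "t \<le> u"
  shows "f t < f s"
proof -
  have "- f s < - f t"
  proof (rule pos_derivative_within_less[where f = "\<lambda>y. - f y" and f' = "\<lambda>y. - f' y"])
    show "\<forall>y\<in>{l..u}. ((\<lambda>y. - f y) has_real_derivative - f' y) (at y within {l..u})"
      using deriv by (auto intro!: derivative_intros)
  qed (use assms in auto)
  then show ?thesis by simp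
qed

section \<open>The four cases\<close>

lemma admissibleD:
  assumes "admissible X f f' f'' a"
  shows "\<forall>y\<in>{1..X}. (f has_real_derivative f' y) (at y within {1..X})"
    and "\<forall>y\<in>{1..X}. (f' has_real_derivative f'' y) (at y within {1..X})"
    and "1 \<le> a" "a \<le> X" "f' a = 1 \<or> f' a = - 1"
proof -
  have "a \<in> {y \<in> {1..X}. f' y = 1 \<or> f' y = - 1}"
    using assms by (simp add: admissible_def)
  then show "1 \<le> a" "a \<le> X" "f' a = 1 \<or> f' a = - 1"
    by simp_all
qed (use assms in \<open>simp_all add: admissible_def\<close>)

lemma floor_set_eq: "floor_set f X = (\<lambda>n. \<lfloor>f (real_of_int n)\<rfloor>) ` {1..\<lfloor>X\<rfloor>}"
  by (simp add: floor_set_def atLeastAtMost_def atLeast_def atMost_def le_floor_iff Collect_conj_eq)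

lemma floor_set_eq_reversed:
  "floor_set f X = (\<lambda>n. \<lfloor>f (real_of_int (- n))\<rfloor>) ` {- \<lfloor>X\<rfloor>..- 1}"
proof -
  have "{1..\<lfloor>X\<rfloor>} = uminus ` {- \<lfloor>X\<rfloor>..- 1}"
    by simp
  then show ?thesis
    unfolding floor_set_eq by (simp only: image_image)
qed

text \<open>
  The bound 3 is the 2 for sequences and an additional 1 for replacing integer parts by
  \<open>X\<close> and \<open>a\<close> themselves.
\<close>
lemma card_floor_set_increasing_convex:
  assumes adm: "admissible X f f' f'' a"
    and pos: "\<forall>y\<in>{1..X}. f' y > 0" and convex: "\<forall>y\<in>{1..X}. f'' y > 0"
  shows "\<bar>real (card (floor_set f X)) - (f (real_of_int \<lfloor>a\<rfloor>) - f 1 + X - a)\<bar> \<le> 3"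
proof -
  note adm = admissibleD[OF adm]
  have "f' a = 1"
    using adm pos by force
  have shallow: "f' y < 1" if "1 \<le> y" "y < a" for y
    using pos_derivative_within_less[OF adm(2) convex, of y a] that adm \<open>f' a = 1\<close> by simp
  have steep: "f' y > 1" if "a < y" "y \<le> X" for y
    using pos_derivative_within_less[OF adm(2) convex, of a y] that adm \<open>f' a = 1\<close> by simp
  have "\<bar>real (card (floor_set f X)) -
      (f (real_of_int \<lfloor>a\<rfloor>) - f (real_of_int 1) + real_of_int (\<lfloor>X\<rfloor> - \<lfloor>a\<rfloor>))\<bar> \<le> 2"
    unfolding floor_set_eq
  proof (rule card_floor_image_shallow_steep)
    show "1 \<le> \<lfloor>a\<rfloor>" "\<lfloor>a\<rfloor> \<le> \<lfloor>X\<rfloor>"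
      using adm by (auto simp: floor_mono)
  next
    fix n assume "1 \<le> n" "n < \<lfloor>X\<rfloor>"
    then have n: "1 \<le> real_of_int n" "real_of_int n + 1 \<le> X"
      by linarith+
    then obtain \<xi> where "real_of_int n < \<xi>" "\<xi> < real_of_int n + 1"
      "f (real_of_int (n + 1)) - f (real_of_int n) = f' \<xi>"
      using unit_increment_within[OF adm(1)] by metis
    then show "f (real_of_int n) \<le> f (real_of_int (n + 1))"
      using pos[rule_format, of \<xi>] n by simp
  next
    fix n assume "1 \<le> n" "n < \<lfloor>a\<rfloor>"
    then have n: "1 \<le> real_of_int n" "real_of_int n + 1 \<le> a"
      by linarith+
    then obtain \<xi> where "real_of_int n < \<xi>" "\<xi> < real_of_int n + 1"
      "f (real_of_int (n + 1)) - f (real_of_int n) = f' \<xi>"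
      using unit_increment_within[OF adm(1), of n] adm by auto
    then show "f (real_of_int (n + 1)) \<le> f (real_of_int n) + 1"
      using shallow[of \<xi>] n by simp
  next
    fix n assume "\<lfloor>a\<rfloor> < n" "n < \<lfloor>X\<rfloor>"
    then have n: "a \<le> real_of_int n" "real_of_int n + 1 \<le> X"
      by linarith+
    then obtain \<xi> where "real_of_int n < \<xi>" "\<xi> < real_of_int n + 1"
      "f (real_of_int (n + 1)) - f (real_of_int n) = f' \<xi>"
      using unit_increment_within[OF adm(1), of n] adm by auto
    then show "f (real_of_int n) + 1 \<le> f (real_of_int (n + 1))"
      using steep[of \<xi>] n by simp
  qed
  then show ?thesis
    by simp linarith
qed

lemma card_floor_set_increasing_concave:
  assumes adm: "admissible X f f' f'' a"
    and pos: "\<forall>y\<in>{1..X}. f' y > 0" and concave: "\<forall>y\<in>{1..X}. f'' y < 0"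
    and cut: "real_of_int \<lfloor>a + 1\<rfloor> \<le> X"
  shows "\<bar>real (card (floor_set f X)) -
    (f (real_of_int \<lfloor>X\<rfloor>) - f (real_of_int \<lfloor>a + 1\<rfloor>) + a)\<bar> \<le> 3"
proof -
  note adm = admissibleD[OF adm]
  have "f' a = 1"
    using adm pos by force
  have steep: "f' y > 1" if "1 \<le> y" "y < a" for y
    using neg_derivative_within_less[OF adm(2) concave, of y a] that adm \<open>f' a = 1\<close> by simp
  have shallow: "f' y < 1" if "a < y" "y \<le> X" for y
    using neg_derivative_within_less[OF adm(2) concave, of a y] that adm \<open>f' a = 1\<close> by simp
  have "\<bar>real (card (floor_set f X)) -
      (f (real_of_int \<lfloor>X\<rfloor>) - f (real_of_int (\<lfloor>a\<rfloor> + 1)) + real_of_int (\<lfloor>a\<rfloor> - 1 + 1))\<bar> \<le> 2"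
    unfolding floor_set_eq
  proof (rule card_floor_image_steep_shallow)
    show "1 \<le> \<lfloor>a\<rfloor> + 1" "\<lfloor>a\<rfloor> < \<lfloor>X\<rfloor>"
      using adm(3) cut le_floor_iff[of "\<lfloor>a + 1\<rfloor>" X] by simp_all
  next
    fix n assume "1 \<le> n" "n < \<lfloor>X\<rfloor>"
    then have n: "1 \<le> real_of_int n" "real_of_int n + 1 \<le> X"
      by linarith+
    then obtain \<xi> where "real_of_int n < \<xi>" "\<xi> < real_of_int n + 1"
      "f (real_of_int (n + 1)) - f (real_of_int n) = f' \<xi>"
      using unit_increment_within[OF adm(1)] by metis
    then show "f (real_of_int n) \<le> f (real_of_int (n + 1))"
      using pos[rule_format, of \<xi>] n by simp
  next
    fix n assume "1 \<le> n" "n < \<lfloor>a\<rfloor>"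
    then have n: "1 \<le> real_of_int n" "real_of_int n + 1 \<le> a"
      by linarith+
    then obtain \<xi> where "real_of_int n < \<xi>" "\<xi> < real_of_int n + 1"
      "f (real_of_int (n + 1)) - f (real_of_int n) = f' \<xi>"
      using unit_increment_within[OF adm(1), of n] adm by auto
    then show "f (real_of_int n) + 1 \<le> f (real_of_int (n + 1))"
      using steep[of \<xi>] n by simp
  next
    fix n assume "\<lfloor>a\<rfloor> < n" "n < \<lfloor>X\<rfloor>"
    then have n: "a \<le> real_of_int n" "real_of_int n + 1 \<le> X"
      by linarith+
    then obtain \<xi> where "real_of_int n < \<xi>" "\<xi> < real_of_int n + 1"
      "f (real_of_int (n + 1)) - f (real_of_int n) = f' \<xi>"
      using unit_increment_within[OF adm(1), of n] adm by auto
    then show "f (real_of_int (n + 1)) \<le> f (real_of_int n) + 1"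
      using shallow[of \<xi>] n by simp
  qed
  then show ?thesis
    by (simp add: add.commute[of 1]) linarith
qed

text \<open>
  Read backwards, the steep part in front comes last, so the reversed sequence is increasing and
  first shallow, then steep, with its cut after \<open>- (\<lfloor>a\<rfloor> + 1)\<close>. The hypothesis \<open>\<lfloor>a + 1\<rfloor> \<le> X\<close>
  ensures that the shallow part is not empty, so that \<open>f\<close> has a value at its first integer.
\<close>
lemma card_floor_set_decreasing_convex:
  assumes adm: "admissible X f f' f'' a"
    and neg: "\<forall>y\<in>{1..X}. f' y < 0" and convex: "\<forall>y\<in>{1..X}. f'' y > 0"
    and cut: "real_of_int \<lfloor>a + 1\<rfloor> \<le> X"
  shows "\<bar>real (card (floor_set f X)) -
    (f (real_of_int \<lfloor>a + 1\<rfloor>) - f (real_of_int \<lfloor>X\<rfloor>) + a)\<bar> \<le> 3"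
proof -
  note adm = admissibleD[OF adm]
  have "f' a = - 1"
    using adm neg by force
  have steep: "f' y < - 1" if "1 \<le> y" "y < a" for y
    using pos_derivative_within_less[OF adm(2) convex, of y a] that adm \<open>f' a = - 1\<close> by simp
  have shallow: "f' y > - 1" if "a < y" "y \<le> X" for y
    using pos_derivative_within_less[OF adm(2) convex, of a y] that adm \<open>f' a = - 1\<close> by simp
  have "\<bar>real (card (floor_set f X)) -
      (f (real_of_int (- (- \<lfloor>a\<rfloor> - 1))) - f (real_of_int (- (- \<lfloor>X\<rfloor>))) +
       real_of_int (- 1 - (- \<lfloor>a\<rfloor> - 1)))\<bar> \<le> 2"
    unfolding floor_set_eq_reversed
  proof (rule card_floor_image_shallow_steep)
    show "- \<lfloor>X\<rfloor> \<le> - \<lfloor>a\<rfloor> - 1" "- \<lfloor>a\<rfloor> - 1 \<le> - 1"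
      using adm(3) cut le_floor_iff[of "\<lfloor>a + 1\<rfloor>" X] by simp_all
  next
    fix n assume "- \<lfloor>X\<rfloor> \<le> n" "n < - 1"
    then have n: "1 \<le> real_of_int (- (n + 1))" "real_of_int (- (n + 1)) + 1 \<le> X"
      by linarith+
    then obtain \<xi> where "real_of_int (- (n + 1)) < \<xi>" "\<xi> < real_of_int (- (n + 1)) + 1"
      "f (real_of_int (- (n + 1) + 1)) - f (real_of_int (- (n + 1))) = f' \<xi>"
      using unit_increment_within[OF adm(1)] by metis
    then show "f (real_of_int (- n)) \<le> f (real_of_int (- (n + 1)))"
      using neg[rule_format, of \<xi>] n by simp
  next
    fix n assume "- \<lfloor>X\<rfloor> \<le> n" "n < - \<lfloor>a\<rfloor> - 1"
    then have n: "a \<le> real_of_int (- (n + 1))" "real_of_int (- (n + 1)) + 1 \<le> X"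
      by linarith+
    then obtain \<xi> where "real_of_int (- (n + 1)) < \<xi>" "\<xi> < real_of_int (- (n + 1)) + 1"
      "f (real_of_int (- (n + 1) + 1)) - f (real_of_int (- (n + 1))) = f' \<xi>"
      using unit_increment_within[OF adm(1), of "- (n + 1)"] adm by auto
    then show "f (real_of_int (- (n + 1))) \<le> f (real_of_int (- n)) + 1"
      using shallow[of \<xi>] n by simp
  next
    fix n assume "- \<lfloor>a\<rfloor> - 1 < n" "n < - 1"
    then have n: "1 \<le> real_of_int (- (n + 1))" "real_of_int (- (n + 1)) + 1 \<le> a"
      by linarith+
    then obtain \<xi> where "real_of_int (- (n + 1)) < \<xi>" "\<xi> < real_of_int (- (n + 1)) + 1"
      "f (real_of_int (- (n + 1) + 1)) - f (real_of_int (- (n + 1))) = f' \<xi>"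
      using unit_increment_within[OF adm(1), of "- (n + 1)"] adm by auto
    then show "f (real_of_int (- n)) + 1 \<le> f (real_of_int (- (n + 1)))"
      using steep[of \<xi>] n by simp
  qed
  then show ?thesis
    by (simp add: add.commute[of 1]) linarith
qed

text \<open>
  Again the order of the two parts is exchanged by reading backwards, now to steep before shallow.
  The steep part is empty if \<open>\<lfloor>a\<rfloor> = \<lfloor>X\<rfloor>\<close>.
\<close>
lemma card_floor_set_decreasing_concave:
  assumes adm: "admissible X f f' f'' a"
    and neg: "\<forall>y\<in>{1..X}. f' y < 0" and concave: "\<forall>y\<in>{1..X}. f'' y < 0"
  shows "\<bar>real (card (floor_set f X)) - (f 1 - f (real_of_int \<lfloor>a\<rfloor>) + X - a)\<bar> \<le> 3"
proof -
  note adm = admissibleD[OF adm]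
  have "f' a = - 1"
    using adm neg by force
  have shallow: "f' y > - 1" if "1 \<le> y" "y < a" for y
    using neg_derivative_within_less[OF adm(2) concave, of y a] that adm \<open>f' a = - 1\<close> by simp
  have steep: "f' y < - 1" if "a < y" "y \<le> X" for y
    using neg_derivative_within_less[OF adm(2) concave, of a y] that adm \<open>f' a = - 1\<close> by simp
  have "\<bar>real (card (floor_set f X)) -
      (f (real_of_int (- (- 1))) - f (real_of_int (- (- \<lfloor>a\<rfloor> - 1 + 1))) +
       real_of_int (- \<lfloor>a\<rfloor> - 1 - (- \<lfloor>X\<rfloor>) + 1))\<bar> \<le> 2"
    unfolding floor_set_eq_reversed
  proof (rule card_floor_image_steep_shallow)
    show "- \<lfloor>X\<rfloor> \<le> - \<lfloor>a\<rfloor> - 1 + 1" "- \<lfloor>a\<rfloor> - 1 < - 1"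
      using adm by (simp_all add: floor_mono less_floor_iff)
  next
    fix n assume "- \<lfloor>X\<rfloor> \<le> n" "n < - 1"
    then have n: "1 \<le> real_of_int (- (n + 1))" "real_of_int (- (n + 1)) + 1 \<le> X"
      by linarith+
    then obtain \<xi> where "real_of_int (- (n + 1)) < \<xi>" "\<xi> < real_of_int (- (n + 1)) + 1"
      "f (real_of_int (- (n + 1) + 1)) - f (real_of_int (- (n + 1))) = f' \<xi>"
      using unit_increment_within[OF adm(1)] by metis
    then show "f (real_of_int (- n)) \<le> f (real_of_int (- (n + 1)))"
      using neg[rule_format, of \<xi>] n by simp
  next
    fix n assume "- \<lfloor>X\<rfloor> \<le> n" "n < - \<lfloor>a\<rfloor> - 1"
    then have n: "a \<le> real_of_int (- (n + 1))" "real_of_int (- (n + 1)) + 1 \<le> X"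
      by linarith+
    then obtain \<xi> where "real_of_int (- (n + 1)) < \<xi>" "\<xi> < real_of_int (- (n + 1)) + 1"
      "f (real_of_int (- (n + 1) + 1)) - f (real_of_int (- (n + 1))) = f' \<xi>"
      using unit_increment_within[OF adm(1), of "- (n + 1)"] adm by auto
    then show "f (real_of_int (- n)) + 1 \<le> f (real_of_int (- (n + 1)))"
      using steep[of \<xi>] n by simp
  next
    fix n assume "- \<lfloor>a\<rfloor> - 1 < n" "n < - 1"
    then have n: "1 \<le> real_of_int (- (n + 1))" "real_of_int (- (n + 1)) + 1 \<le> a"
      by linarith+
    then obtain \<xi> where "real_of_int (- (n + 1)) < \<xi>" "\<xi> < real_of_int (- (n + 1)) + 1"
      "f (real_of_int (- (n + 1) + 1)) - f (real_of_int (- (n + 1))) = f' \<xi>"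
      using unit_increment_within[OF adm(1), of "- (n + 1)"] adm by auto
    then show "f (real_of_int (- (n + 1))) \<le> f (real_of_int (- n)) + 1"
      using shallow[of \<xi>] n by simp
  qed
  then show ?thesis
    by simp linarith
qed

theorem theorem3:
  "\<exists>C::real. \<forall>X f f' f'' a. 0 < X \<longrightarrow> admissible X f f' f'' a \<longrightarrow>
     ((\<forall>y\<in>{1..X}. f' y < 0 \<and> f'' y > 0) \<longrightarrow> real_of_int \<lfloor>a + 1\<rfloor> \<le> X \<longrightarrow>
        \<bar>real (card (floor_set f X)) - (f (real_of_int \<lfloor>a + 1\<rfloor>) - f (real_of_int \<lfloor>X\<rfloor>) + a)\<bar> \<le> C) \<and>
     ((\<forall>y\<in>{1..X}. f' y < 0 \<and> f'' y < 0) \<longrightarrow>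
        \<bar>real (card (floor_set f X)) - (f 1 - f (real_of_int \<lfloor>a\<rfloor>) + X - a)\<bar> \<le> C) \<and>
     ((\<forall>y\<in>{1..X}. f' y > 0 \<and> f'' y > 0) \<longrightarrow>
        \<bar>real (card (floor_set f X)) - (f (real_of_int \<lfloor>a\<rfloor>) - f 1 + X - a)\<bar> \<le> C) \<and>
     ((\<forall>y\<in>{1..X}. f' y > 0 \<and> f'' y < 0) \<longrightarrow> real_of_int \<lfloor>a + 1\<rfloor> \<le> X \<longrightarrow>
        \<bar>real (card (floor_set f X)) - (f (real_of_int \<lfloor>X\<rfloor>) - f (real_of_int \<lfloor>a + 1\<rfloor>) + a)\<bar> \<le> C)"
proof (intro exI[of _ 3] allI impI conjI)
  fix X a :: real and f f' f'' :: "real \<Rightarrow> real"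
  assume adm: "admissible X f f' f'' a"
  note decreasing_convex = card_floor_set_decreasing_convex[OF adm]
    and decreasing_concave = card_floor_set_decreasing_concave[OF adm]
    and increasing_convex = card_floor_set_increasing_convex[OF adm]
    and increasing_concave = card_floor_set_increasing_concave[OF adm]
  {
    assume "\<forall>y\<in>{1..X}. f' y < 0 \<and> f'' y > 0" "real_of_int \<lfloor>a + 1\<rfloor> \<le> X"
    then show "\<bar>real (card (floor_set f X)) -
        (f (real_of_int \<lfloor>a + 1\<rfloor>) - f (real_of_int \<lfloor>X\<rfloor>) + a)\<bar> \<le> 3"
      by (intro decreasing_convex) auto
  next
    assume "\<forall>y\<in>{1..X}. f' y < 0 \<and> f'' y < 0"
    then show "\<bar>real (card (floor_set f X)) - (f 1 - f (real_of_int \<lfloor>a\<rfloor>) + X - a)\<bar> \<le> 3"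
      by (intro decreasing_concave) auto
  next
    assume "\<forall>y\<in>{1..X}. f' y > 0 \<and> f'' y > 0"
    then show "\<bar>real (card (floor_set f X)) - (f (real_of_int \<lfloor>a\<rfloor>) - f 1 + X - a)\<bar> \<le> 3"
      by (intro increasing_convex) auto
  next
    assume "\<forall>y\<in>{1..X}. f' y > 0 \<and> f'' y < 0" "real_of_int \<lfloor>a + 1\<rfloor> \<le> X"
    then show "\<bar>real (card (floor_set f X)) -
        (f (real_of_int \<lfloor>X\<rfloor>) - f (real_of_int \<lfloor>a + 1\<rfloor>) + a)\<bar> \<le> 3"
      by (intro increasing_concave) auto
  }
qed

end
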